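(* Let $A\in\mathbb{R}^{m\times r}$ with $m\ge r$ have full rank, let $z^\star\in\mathbb{R}^r$ have nonnegative entries, $r^\star=\#\operatorname{supp}(z^\star)$, $b=Az^\star$. Apply the LMM subgradient method with $F(x)=x\odot x$ and $h(z)=\|Az-b\|_2$ (i.e. to $\min_{x\in\mathbb{R}^r}\|A(x\odot x)-b\|_2$), initialized at $x_0\in\mathbb{R}^r$ and with the Polyak configuration with parameters $\gamma,C_{\mathtt{lb}},C_{\mathtt{ub}}$ satisfying $$\gamma\le\min\left\{1,\frac{C_{\mathtt{lb}}}{2}\right\},\qquad C_{\mathtt{ub}}\le\frac{1}{64\max\{\sqrt{r-r^\star},1\}}\kappa(A)^{-2},$$ and suppose $$\|x_0\odot x_0-z^\star\|_2\le\frac12\min\left\{\min_{\substack{i,j\in[r]\\ z^\star_i\ne z^\star_j}}|z^\star_i-z^\star_j|,\ \min_{\substack{i\in[r]\\ z^\star_i\ne0}}z^\star_i\right\}.$$ Then the iterates satisfy $$\|x_k\odot x_k-z^\star\|_2^2\le\left(1-\frac{\gamma}{8}\kappa(A)^{-2}\right)^k\|x_0\odot x_0-z^\star\|_2^2\quad\text{for all }k\ge0.$$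
   Context: $\odot$ is the componentwise product, $\operatorname{supp}(z)$ the set of indices of nonzero entries, $\#$ cardinality, $[r]=\{1,\dots,r\}$; a minimum over an empty set is $+\infty$. $\kappa(A)=\sigma_{\max}(A)/\sigma_{\min}(A)$ with $\sigma_{\min}(A)$ the smallest nonzero singular value. LMM (Levenberg-Morrison-Marquardt) subgradient method for $f=h\circ F$. Given $x_0$, stepsizes $\gamma_k>0$ and damping coefficients $\lambda_k>0$: for $k\ge0$ pick any $v_k\in\partial h(F(x_k))$ (convex subdifferential) and set $x_{k+1}=x_k-\gamma_k(\nabla F(x_k)^\top\nabla F(x_k)+\lambda_kI)^{-1}\nabla F(x_k)^\top v_k$, where $\nabla F$ is the Jacobian. Write $z_k=F(x_k)$; let $h^\star$, $\mathcal{Z}^\star$ be the minimum value and set of minimizers of $h$ over $\operatorname{Im}F$, and $\Pi^x$ the orthogonal projection onto the range of $\nabla F(x)$. Polyak configuration with parameters $\gamma>0$, $0<C_{\mathtt{lb}}\le C_{\mathtt{ub}}$: $\gamma_k=\gamma\frac{h(z_k)-h^\star}{\|\Pi^{x_k}v_k\|^2}$ and $C_{\mathtt{lb}}\operatorname{dist}(z_k,\mathcal{Z}^\star)\le\lambda_k\le C_{\mathtt{ub}}\operatorname{dist}(z_k,\mathcal{Z}^\star)$ for all $k$. *)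

theory Defs
  imports "HOL-Analysis.Analysis"
begin

text \<open>
  Square roots of the eigenvalues of \<open>A\<^sup>T A\<close>. Multiplicities are not recorded. When \<open>A\<close> has fewer
  rows than columns this adds at most the value \<open>0\<close> to the usual list of singular values, which
  affects neither the largest nor the smallest nonzero one.
\<close>

definition singular_values :: "real^'n^'m \<Rightarrow> real set" where
  "singular_values A =
     {s. 0 \<le> s \<and> (\<exists>v. v \<noteq> 0 \<and> (transpose A ** A) *v v = s\<^sup>2 *\<^sub>R v)}"

definition sigma_max :: "real^'n^'m \<Rightarrow> real" where
  "sigma_max A = Max (singular_values A)"

definition sigma_min :: "real^'n^'m \<Rightarrow> real" where
  "sigma_min A = Min (singular_values A - {0})"

definition kappa :: "real^'n^'m \<Rightarrow> real" where
  "kappa A = sigma_max A / sigma_min A"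

definition supp :: "real^'n \<Rightarrow> 'n set" where
  "supp z = {i. z $ i \<noteq> 0}"

definition subdifferential :: "('a::real_inner \<Rightarrow> real) \<Rightarrow> 'a \<Rightarrow> 'a set" where
  "subdifferential h z = {v. \<forall>y. h z + v \<bullet> (y - z) \<le> h y}"

definition orth_proj :: "'a::real_inner set \<Rightarrow> 'a \<Rightarrow> 'a" where
  "orth_proj S v = (THE p. p \<in> S \<and> (\<forall>w\<in>S. orthogonal (v - p) w))"

definition min_value :: "('b \<Rightarrow> real) \<Rightarrow> ('a \<Rightarrow> 'b) \<Rightarrow> real" where
  "min_value h F = (INF z\<in>range F. h z)"

definition minimizers :: "('b \<Rightarrow> real) \<Rightarrow> ('a \<Rightarrow> 'b) \<Rightarrow> 'b set" where
  "minimizers h F = {z. is_arg_min h (\<lambda>z. z \<in> range F) z}"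

definition lmm_step ::
  "(real^'n \<Rightarrow> real^'d) \<Rightarrow> real \<Rightarrow> real \<Rightarrow> real^'d \<Rightarrow> real^'n \<Rightarrow> real^'n" where
  "lmm_step F \<gamma> \<mu> v x =
     (let J = jacobian F (at x)
      in x - \<gamma> *\<^sub>R (matrix_inv (transpose J ** J + \<mu> *\<^sub>R mat 1) *v (transpose J *v v)))"

text \<open>
  Stepsizes and damping coefficients must be positive as long as no minimizer has been reached.
  At an iterate \<open>x k\<close> with \<open>F (x k) \<in> minimizers h F\<close> the Polyak rule below forces
  \<open>gam k = 0\<close> and \<open>lam k = 0\<close>, so the iteration stays at \<open>x k\<close>; demanding
  positivity there would exclude the runs that terminate finitely.
\<close>

definition lmm_subgradient_method ::
  "(real^'d \<Rightarrow> real) \<Rightarrow> (real^'n \<Rightarrow> real^'d) \<Rightarrow> (nat \<Rightarrow> real) \<Rightarrow> (nat \<Rightarrow> real) \<Rightarrow>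
   (nat \<Rightarrow> real^'d) \<Rightarrow> (nat \<Rightarrow> real^'n) \<Rightarrow> bool" where
  "lmm_subgradient_method h F gam lam v x \<longleftrightarrow>
     (\<forall>k. (F (x k) \<notin> minimizers h F \<longrightarrow> 0 < gam k \<and> 0 < lam k) \<and>
          v k \<in> subdifferential h (F (x k)) \<and>
          x (Suc k) = lmm_step F (gam k) (lam k) (v k) (x k))"

definition polyak_configuration ::
  "(real^'d \<Rightarrow> real) \<Rightarrow> (real^'n \<Rightarrow> real^'d) \<Rightarrow> real \<Rightarrow> real \<Rightarrow> real \<Rightarrow> (nat \<Rightarrow> real) \<Rightarrow> (nat \<Rightarrow> real) \<Rightarrow>
   (nat \<Rightarrow> real^'d) \<Rightarrow> (nat \<Rightarrow> real^'n) \<Rightarrow> bool" where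
  "polyak_configuration h F \<gamma> C_lb C_ub gam lam v x \<longleftrightarrow>
     0 < \<gamma> \<and> 0 < C_lb \<and> C_lb \<le> C_ub \<and>
     (\<forall>k. gam k = \<gamma> * ((h (F (x k)) - min_value h F) /
                        (norm (orth_proj (range ((*v) (jacobian F (at (x k))))) (v k)))\<^sup>2) \<and>
          C_lb * infdist (F (x k)) (minimizers h F) \<le> lam k \<and>
          lam k \<le> C_ub * infdist (F (x k)) (minimizers h F))"

text \<open>
  Minima are taken in the extended reals, where the infimum of the empty set is \<open>\<infinity>\<close>;
  over the finite, nonempty index sets the infimum is the minimum. Both index sets are empty
  when \<open>z = 0\<close>.
\<close>

definition min_gap :: "real^'n \<Rightarrow> ereal" where
  "min_gap z = (INF (i, j)\<in>{(i, j). z $ i \<noteq> z $ j}. ereal \<bar>z $ i - z $ j\<bar>)"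

definition min_nonzero :: "real^'n \<Rightarrow> ereal" where
  "min_nonzero z = (INF i\<in>supp z. ereal (z $ i))"

end

theory Submission
  imports Defs
begin

text \<open>
  For \<open>F x = x \<odot> x\<close> the Jacobian is \<open>2 diag x\<close>, so a step acts on each coordinate separately. Write
  \<open>z = x \<odot> x\<close>, \<open>e = z - z*\<close>, \<open>p\<^sub>i = 4 z\<^sub>i + \<lambda>\<close> and \<open>D\<^sub>i = 4 z\<^sub>i / p\<^sub>i\<close>, and let \<open>w\<close> be the projection of the
  subgradient \<open>v\<close> onto the coordinates in the support of \<open>x\<close>. Squaring the update of \<open>x\<^sub>i\<close> turns it into
  \<open>e \<mapsto> e - g u\<close> with \<open>u\<^sub>i = D\<^sub>i (w\<^sub>i - g w\<^sub>i\<^sup>2 / p\<^sub>i)\<close>. If \<open>u\<close> were \<open>w\<close>, this would be a Polyak step for a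
  convex function, with gain of order \<open>\<gamma> h\<^sup>2 / \<parallel>w\<parallel>\<^sup>2\<close>; since \<open>\<sigma>\<^sub>m\<^sub>i\<^sub>n \<parallel>e\<parallel> \<le> h\<close> and \<open>\<parallel>w\<parallel> \<le> \<sigma>\<^sub>m\<^sub>a\<^sub>x\<close>, a gain
  of \<open>\<gamma> h\<^sup>2 / \<parallel>w\<parallel>\<^sup>2\<close> means contraction of \<open>\<parallel>e\<parallel>\<^sup>2\<close> by the factor \<open>1 - \<gamma> \<kappa>\<^sup>-\<^sup>2\<close>. The
  errors below cost at most half of the leading gain \<open>2 \<gamma> h\<^sup>2 / \<parallel>w\<parallel>\<^sup>2\<close> of an exact Polyak step, so this factor,
  and with it the weaker \<open>1 - \<gamma>/8 \<kappa>\<^sup>-\<^sup>2\<close>, survives.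

  Three errors separate \<open>u\<close> from \<open>w\<close>, and \<open>lmm_square_coordinate_bounds\<close> controls them one coordinate at a
  time.
  \<^item> Damping multiplies \<open>w\<^sub>i\<close> by \<open>D\<^sub>i\<close>, with \<open>1 - D\<^sub>i = \<lambda> / p\<^sub>i\<close>. On the support of \<open>z*\<close> the iterate is close
    enough to have \<open>z\<^sub>i \<ge> \<parallel>e\<parallel>\<close>, so this is at most \<open>C\<^sub>u\<^sub>b / 4\<close>. Off the support \<open>D\<^sub>i\<close> may be tiny, but there
    \<open>e\<^sub>i = z\<^sub>i\<close> and the product \<open>e\<^sub>i (1 - D\<^sub>i)\<close> is still at most \<open>\<lambda> / 4\<close>. Each such coordinate costs up to
    \<open>\<parallel>e\<parallel>\<close> instead of \<open>\<bar>e\<^sub>i\<bar>\<close>, whence the factor \<open>sqrt (r - r*)\<close> in the bound on \<open>C\<^sub>u\<^sub>b\<close>; the factor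
    \<open>\<kappa>\<^sup>-\<^sup>2\<close> there makes the total at most \<open>h / 128\<close>.
  \<^item> The term quadratic in \<open>g\<close> in the update of \<open>z\<^sub>i\<close> enters the inner product with \<open>e\<close>. Here
    \<open>\<bar>e\<^sub>i\<bar> \<le> z\<^sub>i\<close>, hence \<open>\<bar>e\<^sub>i\<bar> / p\<^sub>i \<le> 1/4\<close>, makes it a multiple of \<open>g \<parallel>w\<parallel>\<^sup>2 = \<gamma> h\<close>.
  \<^item> The same term enters \<open>\<parallel>u\<parallel>\<close>, which stays below \<open>3/2 \<parallel>w\<parallel>\<close> because \<open>\<gamma> \<le> C\<^sub>l\<^sub>b / 2\<close> gives
    \<open>g \<bar>w\<^sub>i\<bar> \<le> \<lambda> / 2\<close>.

  The bound on \<open>C\<^sub>u\<^sub>b\<close> and \<open>C\<^sub>l\<^sub>b \<le> C\<^sub>u\<^sub>b\<close> force \<open>\<gamma> \<le> 1/128\<close>, so that every term of higher order in \<open>\<gamma>\<close> is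
  negligible; \<open>lmm_square_step_contraction\<close> adds everything up. Contraction keeps the iterates in the
  region where \<open>\<parallel>e\<parallel> \<le> z*\<^sub>i / 2\<close> on the support of \<open>z*\<close>, so the step bound can be iterated. Once \<open>e = 0\<close>, the
  Polyak stepsize vanishes and the iteration stops.
\<close>

section \<open>Extremal singular values\<close>

text \<open>
  If \<open>w = M u\<close> were nonzero, moving from \<open>u\<close> a little in direction \<open>- w\<close> would make the form negative. This
  replaces differentiation in the proof that extremal directions are eigenvectors.
\<close>

lemma semidefinite_isotropic_imp_kernel:
  fixes M :: "'a::real_inner \<Rightarrow> 'a"
  assumes lin: "linear M"
    and sym: "\<And>v w. v \<bullet> M w = M v \<bullet> w"
    and psd: "\<And>v. 0 \<le> v \<bullet> M v"
    and iso: "u \<bullet> M u = 0"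
  shows "M u = 0"
proof (rule ccontr)
  assume ne: "M u \<noteq> 0"
  define w where "w = M u"
  define a where "a = w \<bullet> w"
  define c where "c = w \<bullet> M w"
  (* Minimizing 2 t a + t^2 c would give t = - a / c; the shift by 1 covers c = 0. *)
  define t where "t = - (a / (c + 1))"
  have a: "0 < a" using ne by (simp add: a_def w_def)
  have c: "0 \<le> c" using psd by (simp add: c_def)
  have "u \<bullet> M w = a" using sym by (simp add: a_def w_def)
  moreover have "w \<bullet> M u = a" by (simp add: a_def w_def)
  ultimately have "(u + t *\<^sub>R w) \<bullet> M (u + t *\<^sub>R w) = 2 * t * a + t\<^sup>2 * c"
    using iso by (simp add: linear_add[OF lin] linear_scale[OF lin] inner_add_left
        inner_add_right c_def power2_eq_square algebra_simps)
  also have "\<dots> = - (a\<^sup>2 * (c + 2) / (c + 1)\<^sup>2)"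
    using c by (simp add: t_def divide_simps) (simp add: algebra_simps power2_eq_square)
  also have "\<dots> < 0"
    using a c by (simp add: zero_less_mult_iff)
  finally show False
    using psd[of "u + t *\<^sub>R w"] by simp
qed

lemma inner_gram_matrix:
  fixes A :: "real^'n^'m"
  shows "v \<bullet> ((transpose A ** A) *v w) = (A *v v) \<bullet> (A *v w)"
  by (metis dot_lmul_matrix matrix_vector_mul_assoc transpose_transpose vector_transpose_matrix)

text \<open>
  Taking \<open>c = 1\<close> treats a minimal stretch and \<open>c = - 1\<close> a maximal one: either way
  \<open>c (A\<^sup>T A - s\<^sup>2 I)\<close> is positive semidefinite and isotropic at \<open>u\<close>, so \<open>u\<close> is an eigenvector.
\<close>

lemma extremal_stretch_singular_value:
  fixes A :: "real^'n^'m" and c :: real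
  assumes c: "c \<noteq> 0"
    and ext: "\<And>v. 0 \<le> c * ((norm (A *v v))\<^sup>2 - s\<^sup>2 * (norm v)\<^sup>2)"
    and u: "u \<noteq> 0" "(norm (A *v u))\<^sup>2 = s\<^sup>2 * (norm u)\<^sup>2"
    and s: "0 \<le> s"
  shows "s \<in> singular_values A"
proof -
  define M where "M = (\<lambda>v. c *\<^sub>R ((transpose A ** A) *v v - s\<^sup>2 *\<^sub>R v))"
  have lin: "linear M"
    unfolding M_def
    by (intro linear_compose_scale_right linear_compose_sub matrix_vector_mul_linear linear_scale_self)
  have expand: "v \<bullet> M w = c * ((A *v v) \<bullet> (A *v w) - s\<^sup>2 * (v \<bullet> w))" for v w
    by (simp add: M_def inner_diff_right inner_gram_matrix)
  have "M u = 0"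
  proof (rule semidefinite_isotropic_imp_kernel[OF lin])
    show "v \<bullet> M w = M v \<bullet> w" for v w
      using expand[of v w] expand[of w v] by (simp add: inner_commute)
    show "0 \<le> v \<bullet> M v" for v
      using ext[of v] by (simp add: expand power2_norm_eq_inner)
    show "u \<bullet> M u = 0"
      using u by (simp add: expand power2_norm_eq_inner)
  qed
  then show ?thesis
    using c u s by (auto simp: M_def singular_values_def)
qed

text \<open>
  Eigenvectors of a symmetric matrix for distinct eigenvalues are orthogonal, and an orthogonal family of
  nonzero vectors in a Euclidean space is finite.
\<close>

lemma finite_singular_values:
  fixes A :: "real^'n^'m"
  shows "finite (singular_values A)"
proof -
  have "\<forall>s\<in>singular_values A. \<exists>v. v \<noteq> 0 \<and> (transpose A ** A) *v v = s\<^sup>2 *\<^sub>R v"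
    by (auto simp: singular_values_def)
  then obtain f where f: "\<And>s. s \<in> singular_values A \<Longrightarrow> f s \<noteq> 0"
    "\<And>s. s \<in> singular_values A \<Longrightarrow> (transpose A ** A) *v f s = s\<^sup>2 *\<^sub>R f s"
    by metis
  have orth: "f s \<bullet> f t = 0" if "s \<in> singular_values A" "t \<in> singular_values A" "s \<noteq> t" for s t
  proof -
    have "t\<^sup>2 * (f s \<bullet> f t) = s\<^sup>2 * (f s \<bullet> f t)"
      using inner_gram_matrix[of "f s" A "f t"] inner_gram_matrix[of "f t" A "f s"] that
      by (simp add: f inner_commute)
    moreover have "s\<^sup>2 \<noteq> t\<^sup>2"
      using that by (simp add: singular_values_def power2_eq_iff_nonneg)
    ultimately show ?thesis by simp
  qed
  have "inj_on f (singular_values A)"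
    by (rule inj_onI) (metis f(1) inner_eq_zero_iff orth)
  moreover have "finite (f ` singular_values A)"
    by (rule pairwise_orthogonal_imp_finite) (auto simp: pairwise_def orthogonal_def intro!: orth)
  ultimately show ?thesis
    using finite_imageD by blast
qed

text \<open>
  By compactness \<open>norm (A *v v)\<close> attains its extrema on the unit sphere, and both are singular values;
  the smaller one is nonzero by injectivity.
\<close>

lemma singular_value_bounds:
  fixes A :: "real^'n^'m"
  assumes inj: "inj ((*v) A)"
  shows "0 < sigma_min A" "sigma_min A \<le> sigma_max A"
    and "\<And>v. sigma_min A * norm v \<le> norm (A *v v)"
    and "\<And>v. norm (A *v v) \<le> sigma_max A * norm v"
proof -
  let ?S = "sphere (0 :: real^'n) 1"
  have cont: "continuous_on ?S (\<lambda>v. norm (A *v v))"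
    by (intro continuous_intros linear_continuous_on
        linear_conv_bounded_linear[THEN iffD1] matrix_vector_mul_linear)
  have "axis undefined 1 \<in> ?S" by simp
  then have ne: "?S \<noteq> {}" by blast
  obtain p where p: "p \<in> ?S" "\<And>v. v \<in> ?S \<Longrightarrow> norm (A *v p) \<le> norm (A *v v)"
    using continuous_attains_inf[OF compact_sphere ne cont] by blast
  obtain q where q: "q \<in> ?S" "\<And>v. v \<in> ?S \<Longrightarrow> norm (A *v v) \<le> norm (A *v q)"
    using continuous_attains_sup[OF compact_sphere ne cont] by blast
  have scale: "norm (A *v ((1 / norm v) *\<^sub>R v)) = norm (A *v v) / norm v" for v
    by (simp add: matrix_vector_mult_scaleR divide_inverse_commute)
  have lower: "norm (A *v p) * norm v \<le> norm (A *v v)" for v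
    using p(2)[of "(1 / norm v) *\<^sub>R v"] by (cases "v = 0")
      (simp_all add: scale pos_le_divide_eq pos_divide_le_eq)
  have upper: "norm (A *v v) \<le> norm (A *v q) * norm v" for v
    using q(2)[of "(1 / norm v) *\<^sub>R v"] by (cases "v = 0")
      (simp_all add: scale pos_le_divide_eq pos_divide_le_eq)
  have "p \<noteq> 0" "q \<noteq> 0" using p q by auto
  have "norm (A *v p) \<in> singular_values A"
    using p \<open>p \<noteq> 0\<close> power_mono[OF lower, where n = 2]
    by (intro extremal_stretch_singular_value[where c = 1 and u = p])
      (simp_all add: power_mult_distrib)
  moreover have "norm (A *v q) \<in> singular_values A"
    using q \<open>q \<noteq> 0\<close> power_mono[OF upper, where n = 2]
    by (intro extremal_stretch_singular_value[where c = "- 1" and u = q])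
      (simp_all add: power_mult_distrib)
  moreover have "norm (A *v p) \<noteq> 0"
    using \<open>p \<noteq> 0\<close> inj by (metis injD matrix_vector_mult_0_right norm_eq_zero)
  ultimately have mem: "norm (A *v p) \<in> singular_values A - {0}" "norm (A *v q) \<in> singular_values A"
    by auto
  note fin = finite_singular_values[of A]
  have "sigma_min A \<in> singular_values A - {0}"
    unfolding sigma_min_def using fin mem by (intro Min_in) auto
  then show "0 < sigma_min A" "sigma_min A \<le> sigma_max A"
    using fin by (auto simp: singular_values_def[of A] less_le sigma_max_def)
  have "sigma_min A \<le> norm (A *v p)" "norm (A *v q) \<le> sigma_max A"
    unfolding sigma_min_def sigma_max_def using fin mem by auto
  note bounds = this[THEN mult_right_mono, OF norm_ge_zero]
  show "sigma_min A * norm v \<le> norm (A *v v)" for v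
    using bounds(1) lower by (rule order_trans)
  show "norm (A *v v) \<le> sigma_max A * norm v" for v
    using upper bounds(2) by (rule order_trans)
qed

section \<open>The method for the componentwise square\<close>

lemma jacobian_square:
  fixes x :: "real^'n"
  shows "jacobian (\<lambda>x. x * x) (at x) = (\<chi> i j. if i = j then 2 * x $ i else 0)"
proof -
  have "bounded_bilinear ((*) :: real^'n \<Rightarrow> real^'n \<Rightarrow> real^'n)"
    unfolding bilinear_conv_bounded_bilinear[symmetric] bilinear_def
    by (auto intro!: linearI simp: vec_eq_iff algebra_simps)
  from bounded_bilinear.FDERIV[OF this has_derivative_ident has_derivative_ident]
  have "((\<lambda>x. x * x) has_derivative (\<lambda>h. x * h + h * x)) (at x)" .
  then have "frechet_derivative (\<lambda>x. x * x) (at x) = (\<lambda>h. x * h + h * x)"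
    by (rule frechet_derivative_at[symmetric])
  then show ?thesis
    by (simp add: jacobian_def matrix_def vec_eq_iff axis_def)
qed

lemma diagonal_matrix_vector_mult:
  fixes v :: "real^'n"
  shows "(\<chi> i j. if i = j then d i else 0) *v v = (\<chi> i. d i * v $ i)"
  by (simp add: vec_eq_iff matrix_vector_mult_def if_distrib[of "\<lambda>y. y * _"] cong: if_cong)

text \<open>The matrix inverted in a step is diagonal with entries \<open>4 x\<^sub>i\<^sup>2 + mu\<close>, so a step decouples.\<close>

lemma lmm_step_square:
  fixes x v :: "real^'n"
  assumes mu: "0 < mu"
  shows "lmm_step (\<lambda>x. x * x) g mu v x
           = (\<chi> i. x $ i - g * (2 * x $ i * v $ i / (4 * (x $ i)\<^sup>2 + mu)))"
proof -
  define d where "d i = 4 * (x $ i)\<^sup>2 + mu" for i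
  define J :: "real^'n^'n" where "J = (\<chi> i j. if i = j then 2 * x $ i else 0)"
  define D :: "real^'n^'n" where "D = (\<chi> i j. if i = j then d i else 0)"
  have d: "d i \<noteq> 0" for i
    using mu by (simp add: d_def add_nonneg_pos less_imp_neq[symmetric])
  have Jv: "J *v w = (\<chi> i. 2 * x $ i * w $ i)" for w
    by (simp add: J_def diagonal_matrix_vector_mult)
  have JT: "transpose J = J"
    by (simp add: J_def transpose_def vec_eq_iff)
  have gram: "transpose J ** J + mu *\<^sub>R mat 1 = D"
  proof (rule matrix_eq[THEN iffD2], rule allI)
    fix w :: "real^'n"
    have "(transpose J ** J + mu *\<^sub>R mat 1) *v w = J *v (J *v w) + mu *\<^sub>R w"
      by (simp add: JT matrix_vector_mult_add_rdistrib matrix_vector_mul_assoc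
          scaleR_matrix_vector_assoc[symmetric])
    also have "\<dots> = D *v w"
      unfolding D_def diagonal_matrix_vector_mult
      by (simp add: Jv vec_eq_iff d_def algebra_simps power2_eq_square)
    finally show "(transpose J ** J + mu *\<^sub>R mat 1) *v w = D *v w" .
  qed
  have inv: "matrix_inv D *v w = (\<chi> i. w $ i / d i)" for w
  proof -
    define E :: "real^'n^'n" where "E = (\<chi> i j. if i = j then 1 / d i else 0)"
    have Dv: "D *v u = (\<chi> i. d i * u $ i)" and Ev: "E *v u = (\<chi> i. u $ i / d i)" for u
      by (simp_all add: D_def E_def diagonal_matrix_vector_mult)
    have DE: "D ** E = mat 1" "E ** D = mat 1"
      by (simp_all add: matrix_eq matrix_vector_mul_assoc[symmetric] Dv Ev vec_eq_iff d)
    then have "\<exists>B. D ** B = mat 1 \<and> B ** D = mat 1" by blast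
    then have "matrix_inv D ** D = mat 1"
      unfolding matrix_inv_def by (rule someI2_ex) (rule conjunct2)
    then have "matrix_inv D ** D ** E = E" by simp
    then have "matrix_inv D = E"
      by (simp only: matrix_mul_assoc[symmetric] DE matrix_mul_rid)
    then show ?thesis by (simp add: Ev)
  qed
  have "lmm_step (\<lambda>x. x * x) g mu v x = x - g *\<^sub>R (\<chi> i. (transpose J *v v) $ i / d i)"
    by (simp only: lmm_step_def Let_def jacobian_square J_def[symmetric] gram inv)
  then show ?thesis
    by (simp only: JT Jv) (simp add: vec_eq_iff d_def)
qed

lemma orth_proj_range_jacobian_square:
  fixes x v :: "real^'n"
  shows "orth_proj (range ((*v) (jacobian (\<lambda>x. x * x) (at x)))) v
           = (\<chi> i. if x $ i = 0 then 0 else v $ i)"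
proof -
  have range_eq: "range ((*v) (jacobian (\<lambda>x. x * x) (at x))) = {w. \<forall>i. x $ i = 0 \<longrightarrow> w $ i = 0}"
  proof -
    have Jv: "jacobian (\<lambda>x. x * x) (at x) *v w = (\<chi> i. 2 * x $ i * w $ i)" for w
      by (simp add: jacobian_square diagonal_matrix_vector_mult)
    have "w \<in> range (\<lambda>w. \<chi> i. 2 * x $ i * w $ i)" if "\<forall>i. x $ i = 0 \<longrightarrow> w $ i = 0" for w
      using that by (intro image_eqI[where x = "\<chi> i. w $ i / (2 * x $ i)"]) (auto simp: vec_eq_iff)
    then show ?thesis
      by (auto simp: Jv)
  qed
  let ?p = "\<chi> i. if x $ i = 0 then 0 else v $ i"
  show ?thesis
    unfolding orth_proj_def range_eq
  proof (rule the_equality)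
    show "?p \<in> {w. \<forall>i. x $ i = 0 \<longrightarrow> w $ i = 0} \<and>
      (\<forall>w\<in>{w. \<forall>i. x $ i = 0 \<longrightarrow> w $ i = 0}. orthogonal (v - ?p) w)"
      by (auto simp: orthogonal_def inner_vec_def intro!: sum.neutral)
  next
    fix p
    assume "p \<in> {w. \<forall>i. x $ i = 0 \<longrightarrow> w $ i = 0} \<and>
      (\<forall>w\<in>{w. \<forall>i. x $ i = 0 \<longrightarrow> w $ i = 0}. orthogonal (v - p) w)"
    then have p0: "\<And>i. x $ i = 0 \<Longrightarrow> p $ i = 0"
      and orth: "\<And>w. (\<And>i. x $ i = 0 \<Longrightarrow> w $ i = 0) \<Longrightarrow> orthogonal (v - p) w"
      by auto
    have "p $ i = v $ i" if "x $ i \<noteq> 0" for i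
    proof -
      have "axis i (1 :: real) $ j = 0" if "x $ j = 0" for j
        using that \<open>x $ i \<noteq> 0\<close> by (auto simp: axis_def)
      then show ?thesis
        using orth[of "axis i 1"] by (simp add: orthogonal_def inner_axis)
    qed
    then show "p = ?p"
      using p0 by (simp add: vec_eq_iff)
  qed
qed

text \<open>
  A nonnegative \<open>zs\<close> is the square of its componentwise root, so a minimizer of \<open>h\<close> that is unique on the whole
  space remains the only one over the range of the square.
\<close>

lemma square_minimizer:
  fixes zs :: "real^'n" and h :: "real^'n \<Rightarrow> real"
  assumes zs: "\<And>i. 0 \<le> zs $ i"
    and h: "h zs = 0" "\<And>z. z \<noteq> zs \<Longrightarrow> 0 < h z"
  shows "min_value h (\<lambda>x. x * x) = 0" "minimizers h (\<lambda>x. x * x) = {zs}"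
proof -
  have mem: "zs \<in> range (\<lambda>x. x * x)"
    using zs by (intro image_eqI[where x = "\<chi> i. sqrt (zs $ i)"]) (auto simp: vec_eq_iff)
  have nonneg: "0 \<le> h z" for z
    using h by (cases "z = zs") (auto intro: less_imp_le)
  show "min_value h (\<lambda>x. x * x) = 0"
    unfolding min_value_def using nonneg h(1) mem
    by (intro cInf_eq_minimum) (auto intro: image_eqI[where x = zs])
  have "is_arg_min h (\<lambda>z. z \<in> range (\<lambda>x. x * x)) z \<longleftrightarrow> z = zs" for z
  proof
    assume "is_arg_min h (\<lambda>z. z \<in> range (\<lambda>x. x * x)) z"
    then have "\<not> h zs < h z" using mem unfolding is_arg_min_def by blast
    then show "z = zs" using h by fastforce
  next
    assume "z = zs"
    then show "is_arg_min h (\<lambda>z. z \<in> range (\<lambda>x. x * x)) z"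
      using mem nonneg h(1) unfolding is_arg_min_def by (metis not_less)
  qed
  then show "minimizers h (\<lambda>x. x * x) = {zs}"
    unfolding minimizers_def by blast
qed

text \<open>
  Testing the subgradient inequality at \<open>zs\<close> gives the first bound; testing it at \<open>z + v\<close>, together with the
  Lipschitz constant \<open>L\<close> of the residual norm, gives the second.
\<close>

lemma norm_residual_subgradient:
  fixes A :: "real^'n^'m"
  assumes v: "v \<in> subdifferential (\<lambda>z. norm (A *v z - A *v zs)) z"
    and L: "\<And>w. norm (A *v w) \<le> L * norm w"
  shows "norm (A *v (z - zs)) \<le> v \<bullet> (z - zs)" "norm v \<le> L"
proof -
  have sub: "norm (A *v z - A *v zs) + v \<bullet> (y - z) \<le> norm (A *v y - A *v zs)" for y
    using v by (simp add: subdifferential_def)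
  show "norm (A *v (z - zs)) \<le> v \<bullet> (z - zs)"
    using sub[of zs] by (simp add: matrix_vector_mult_diff_distrib inner_diff_right)
  have "norm (A *v (z + v) - A *v zs) \<le> norm (A *v z - A *v zs) + norm (A *v v)"
    using norm_triangle_ineq[of "A *v z - A *v zs" "A *v v"]
    by (simp add: matrix_vector_right_distrib algebra_simps)
  then have "norm v * norm v \<le> L * norm v"
    using sub[of "z + v"] L[of v] by (simp add: power2_norm_eq_inner[symmetric] power2_eq_square)
  then show "norm v \<le> L"
    using L[of "axis undefined 1"] by (cases "v = 0") (auto simp: mult_le_cancel_right order_trans[OF norm_ge_zero])
qed

section \<open>One step and the convergence rate\<close>

text \<open>
  One coordinate of a step, with \<open>z = x\<^sub>i\<^sup>2\<close> and target \<open>t\<close>; \<open>d\<close> is the distance of the whole iterate from the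
  target. The first bound compares the descent along \<open>u\<close> with that along the undamped direction \<open>w\<close>. A
  coordinate with \<open>t = 0\<close> is charged \<open>d\<close> in place of its own error, since there \<open>z\<close> may be
  arbitrarily small compared with the damping.
\<close>

lemma lmm_square_coordinate_bounds:
  fixes z t mu g w d c :: real
  assumes z: "0 \<le> z" and t: "0 \<le> t" and mu: "0 < mu" "mu \<le> c * d" and g: "0 \<le> g"
    and near: "\<bar>z - t\<bar> \<le> d" "t \<noteq> 0 \<Longrightarrow> d \<le> t / 2"
    and small: "g * \<bar>w\<bar> \<le> mu / 2"
  defines "u \<equiv> 4 * z / (4 * z + mu) * (w - g * w\<^sup>2 / (4 * z + mu))"
  shows "(z - t) * w - c / 4 * (\<bar>w\<bar> * (if t = 0 then d else \<bar>z - t\<bar>)) - g / 4 * w\<^sup>2 \<le> (z - t) * u"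
    and "u\<^sup>2 \<le> 9 / 4 * w\<^sup>2"
proof -
  define p where "p = 4 * z + mu"
  define D where "D = 4 * z / p"
  have p: "0 < p" "mu \<le> p" "4 * z \<le> p" using z mu by (auto simp: p_def)
  have D: "0 \<le> D" "D \<le> 1" "1 - D = mu / p"
    using p z by (auto simp: D_def p_def field_simps)
  have d: "0 \<le> d" using near(1) by linarith
  have cd: "0 \<le> c"
  proof (rule ccontr)
    assume "\<not> 0 \<le> c"
    then have "c * d \<le> 0" using d by (simp add: mult_nonpos_nonneg)
    then show False using mu by simp
  qed
  have u: "u = D * (w - g * w\<^sup>2 / p)" by (simp add: u_def D_def p_def)
  have far: "d \<le> z" if "t \<noteq> 0" using near(1) near(2)[OF that] by linarith
  have err1: "\<bar>z - t\<bar> * (1 - D) \<le> c / 4 * (if t = 0 then d else \<bar>z - t\<bar>)"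
  proof (cases "t = 0")
    case True
    have "z * mu / p \<le> mu / 4"
      using p z mu by (simp add: field_simps)
    then show ?thesis using True mu z by (simp add: D)
  next
    case False
    have "mu / p \<le> c / 4"
    proof -
      have "mu \<le> c * z" using mu(2) mult_left_mono[OF far[OF False] cd] by linarith
      then have "4 * mu \<le> c * p" using mult_left_mono[OF p(3) cd] by simp
      then show ?thesis using p by (simp add: field_simps)
    qed
    then have "\<bar>z - t\<bar> * (mu / p) \<le> \<bar>z - t\<bar> * (c / 4)"
      by (intro mult_left_mono) auto
    then show ?thesis using False by (simp add: D mult.commute)
  qed
  have err2: "\<bar>z - t\<bar> * D / p \<le> 1 / 4"
  proof -
    have "\<bar>z - t\<bar> \<le> z" using near(1) far z by (cases "t = 0") auto
    then have "\<bar>z - t\<bar> / p \<le> 1 / 4" using p by (simp add: field_simps)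
    then have "\<bar>z - t\<bar> / p * D \<le> 1 / 4 * 1" using D p by (intro mult_mono) auto
    then show ?thesis by simp
  qed
  have "(z - t) * w - (z - t) * u = (z - t) * (1 - D) * w + g * w\<^sup>2 * ((z - t) * D / p)"
    by (simp add: u algebra_simps)
  also have "\<dots> \<le> \<bar>(z - t) * (1 - D) * w\<bar> + g * w\<^sup>2 * \<bar>(z - t) * D / p\<bar>"
    using g by (intro add_mono mult_left_mono abs_ge_self) auto
  also have "\<dots> = (\<bar>z - t\<bar> * (1 - D)) * \<bar>w\<bar> + g * w\<^sup>2 * (\<bar>z - t\<bar> * D / p)"
    using D p mu by (simp add: abs_mult)
  also have "\<dots> \<le> (c / 4 * (if t = 0 then d else \<bar>z - t\<bar>)) * \<bar>w\<bar> + g * w\<^sup>2 * (1 / 4)"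
    using g by (intro add_mono mult_left_mono mult_right_mono err1 err2) auto
  finally show "(z - t) * w - c / 4 * (\<bar>w\<bar> * (if t = 0 then d else \<bar>z - t\<bar>)) - g / 4 * w\<^sup>2
      \<le> (z - t) * u"
    by (simp add: algebra_simps)
  have "\<bar>g * w / p\<bar> \<le> 1 / 2"
    using small g p by (simp add: abs_mult field_simps)
  then have "\<bar>1 - g * w / p\<bar> \<le> 3 / 2" by linarith
  then have "D * \<bar>1 - g * w / p\<bar> \<le> 1 * (3 / 2)" using D by (intro mult_mono) auto
  then have "\<bar>w\<bar> * (D * \<bar>1 - g * w / p\<bar>) \<le> \<bar>w\<bar> * (3 / 2)" by (intro mult_left_mono) auto
  moreover have "u = w * (D * (1 - g * w / p))" by (simp add: u power2_eq_square algebra_simps)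
  ultimately have "\<bar>u\<bar> \<le> 3 / 2 * \<bar>w\<bar>" using D by (simp add: abs_mult)
  then have "\<bar>u\<bar>\<^sup>2 \<le> (3 / 2 * \<bar>w\<bar>)\<^sup>2" by (intro power_mono) auto
  then show "u\<^sup>2 \<le> 9 / 4 * w\<^sup>2" by (simp add: power_mult_distrib power2_eq_square)
qed

text \<open>
  Summing the coordinate bounds gives \<open>e \<bullet> u \<ge> (127/128 - \<gamma>/4) h\<close> and \<open>\<parallel>u\<parallel>\<^sup>2 \<le> 9/4 \<parallel>w\<parallel>\<^sup>2\<close>. Since
  \<open>g \<parallel>w\<parallel>\<^sup>2 = \<gamma> h\<close>, the squared error decreases by at least \<open>g h (2 - 1/64 - 11/4 \<gamma>) \<ge> g h\<close>, and
  \<open>g h = \<gamma> (h / \<parallel>w\<parallel>)\<^sup>2\<close> is at least \<open>\<gamma> (s / L)\<^sup>2\<close> times the squared error. The constant \<open>s\<close>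
  stands for the sharpness of the outer function and \<open>L\<close> for its Lipschitz constant.
\<close>

lemma lmm_square_step_contraction:
  fixes x zs v :: "real^'n" and h s L g mu \<gamma> C_lb C_ub :: real
  defines "e \<equiv> x * x - zs"
    and "w \<equiv> (\<chi> i. if x $ i = 0 then 0 else v $ i)"
    and "M \<equiv> max (sqrt (real CARD('n) - real (card (supp zs)))) 1"
  assumes zs: "\<And>i. 0 \<le> zs $ i"
    and e: "e \<noteq> 0"
    and near: "\<And>i. zs $ i \<noteq> 0 \<Longrightarrow> norm e \<le> zs $ i / 2"
    and s: "0 < s" "s \<le> L"
    and h: "s * norm e \<le> h" "h \<le> v \<bullet> e"
    and v: "norm v \<le> L"
    and \<gamma>: "0 < \<gamma>" "\<gamma> \<le> C_lb / 2"
    and C: "C_lb \<le> C_ub" "C_ub \<le> 1 / (64 * M) * (s / L)\<^sup>2"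
    and g: "g = \<gamma> * (h / (norm w)\<^sup>2)"
    and mu: "C_lb * norm e \<le> mu" "mu \<le> C_ub * norm e"
    and x': "x' = (\<chi> i. x $ i - g * (2 * x $ i * v $ i / (4 * (x $ i)\<^sup>2 + mu)))"
  shows "(norm (x' * x' - zs))\<^sup>2 \<le> (1 - \<gamma> * (s / L)\<^sup>2) * (norm e)\<^sup>2"
proof -
  define d where "d = norm e"
  define u where "u = (\<chi> i. 4 * (x $ i)\<^sup>2 / (4 * (x $ i)\<^sup>2 + mu)
                        * (w $ i - g * (w $ i)\<^sup>2 / (4 * (x $ i)\<^sup>2 + mu)))"
  (* The weights of the damping error; Cauchy-Schwarz against w produces the square root in M. *)
  define q where "q = (\<chi> i. if zs $ i = 0 then d else \<bar>e $ i\<bar>)"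
  have d: "0 < d" using e by (simp add: d_def)
  have L: "0 < L" using s by simp
  have M: "1 \<le> M" by (simp add: M_def)
  have ratio: "0 \<le> s / L" "s / L \<le> 1" using s by auto
  have ratio2: "(s / L)\<^sup>2 \<le> 1" using ratio by (simp add: power_le_one)
  have C_ubM: "C_ub * M \<le> (s / L)\<^sup>2 / 64"
    using C(2) M pos_le_divide_eq[of "64 * M" C_ub "(s / L)\<^sup>2"] by simp
  have C_lb: "0 < C_lb" using \<gamma> by simp
  have "C_ub * 1 \<le> C_ub * M" using C_lb C(1) M by (intro mult_left_mono) auto
  then have \<gamma>': "\<gamma> \<le> 1 / 128" using C_ubM C(1) \<gamma>(2) ratio2 by linarith
  have h0: "0 < h" using h(1) s d by (smt (verit) d_def mult_pos_pos)
  have mu0: "0 < mu" using mu(1) C_lb d by (smt (verit) d_def mult_pos_pos)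
  have ei: "\<bar>e $ i\<bar> \<le> d" for i using component_le_norm_cart[of e i] by (simp add: d_def)
  (* A vanishing x_i on the support of zs would have error zs_i, beyond the allowed zs_i / 2. Hence
     projecting v onto the support of x does not change its inner product with e. *)
  have e_zero: "e $ i = 0" if "x $ i = 0" for i
  proof (cases "zs $ i = 0")
    case False
    then have "\<bar>zs $ i\<bar> \<le> zs $ i / 2" using ei[of i] near[OF False] that by (simp add: e_def d_def)
    then show ?thesis using False zs[of i] by simp
  qed (use that in \<open>simp add: e_def\<close>)
  have "v \<bullet> e = w \<bullet> e"
    unfolding inner_vec_def by (rule sum.cong) (auto simp: w_def e_zero)
  then have hw: "h \<le> w \<bullet> e" using h by simp
  then have hwd: "h \<le> norm w * d" using norm_cauchy_schwarz[of w e] by (simp add: d_def)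
  have w0: "0 < norm w" using hwd h0 by auto
  have "norm w \<le> norm v" by (rule norm_le_componentwise_cart) (simp add: w_def)
  then have wL: "norm w \<le> L" using v by simp
  have g0: "0 < g" using \<gamma> h0 w0 by (simp add: g)
  have gw: "g * (norm w)\<^sup>2 = \<gamma> * h" using w0 by (simp add: g)
  have small: "g * \<bar>w $ i\<bar> \<le> mu / 2" for i
  proof -
    have "g * \<bar>w $ i\<bar> \<le> g * norm w"
      using g0 component_le_norm_cart[of w i] by (intro mult_left_mono) auto
    also have "\<dots> = \<gamma> * (h / norm w)" using w0 by (simp add: g power2_eq_square)
    also have "\<dots> \<le> (C_lb / 2) * d"
      using hwd w0 \<gamma> C_lb h0 by (intro mult_mono) (auto simp: field_simps)
    also have "\<dots> \<le> mu / 2" using mu(1) by (simp add: d_def)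
    finally show ?thesis .
  qed
  have coord:
    "e $ i * w $ i - C_ub / 4 * (\<bar>w $ i\<bar> * q $ i) - g / 4 * (w $ i)\<^sup>2 \<le> e $ i * u $ i"
    "(u $ i)\<^sup>2 \<le> 9 / 4 * (w $ i)\<^sup>2" for i
    using lmm_square_coordinate_bounds[of "(x $ i)\<^sup>2" "zs $ i" mu C_ub d g "w $ i"]
      zs mu0 mu(2) g0 ei[of i] near[of i] small[of i]
    by (auto simp: e_def d_def q_def u_def power2_eq_square)
  have "x' * x' - zs = e - g *\<^sub>R u"
  proof -
    have "y * y = x\<^sub>0\<^sup>2 - g * (4 * x\<^sub>0\<^sup>2 / p * (v\<^sub>0 - g * v\<^sub>0\<^sup>2 / p))"
      if "y = x\<^sub>0 - g * (2 * x\<^sub>0 * v\<^sub>0 / p)" for y x\<^sub>0 v\<^sub>0 p :: real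
      unfolding that by (simp add: algebra_simps power2_eq_square diff_divide_distrib)
    then show ?thesis
      by (auto simp: vec_eq_iff x' e_def u_def w_def power2_eq_square)
  qed
  then have step: "(norm (x' * x' - zs))\<^sup>2 = d\<^sup>2 - 2 * g * (e \<bullet> u) + g\<^sup>2 * (norm u)\<^sup>2"
    by (simp only: d_def power2_norm_eq_inner)
      (simp add: inner_diff_left inner_diff_right inner_commute[of u e] power2_eq_square algebra_simps)
  have norm2: "(norm y)\<^sup>2 = (\<Sum>i\<in>UNIV. (y $ i)\<^sup>2)" for y :: "real^'n"
    by (simp only: power2_norm_eq_inner inner_vec_def) (simp add: power2_eq_square)
  have u_bound: "(norm u)\<^sup>2 \<le> 9 / 4 * (norm w)\<^sup>2"
    unfolding norm2 sum_distrib_left by (intro sum_mono coord)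
  have q_bound: "norm q \<le> 2 * M * d"
  proof -
    have "(norm q)\<^sup>2 \<le> (\<Sum>i\<in>UNIV. (e $ i)\<^sup>2 + (if i \<in> - supp zs then d\<^sup>2 else 0))"
      unfolding norm2 by (intro sum_mono) (auto simp: q_def supp_def)
    also have "\<dots> = d\<^sup>2 + real (card (- supp zs)) * d\<^sup>2"
      unfolding sum.distrib norm2[symmetric] d_def by (simp add: sum.If_cases Compl_eq)
    also have "real (card (- supp zs)) = real CARD('n) - real (card (supp zs))"
      by (simp add: Compl_eq_Diff_UNIV card_Diff_subset of_nat_diff card_mono)
    also have "\<dots> \<le> M\<^sup>2"
      unfolding M_def by (rule sqrt_le_D) simp
    finally have "(norm q)\<^sup>2 \<le> d\<^sup>2 + M\<^sup>2 * d\<^sup>2" by (simp add: mult_right_mono)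
    also have "\<dots> \<le> (2 * M * d)\<^sup>2"
    proof -
      have "d\<^sup>2 \<le> M\<^sup>2 * d\<^sup>2" using M mult_right_mono[of 1 "M\<^sup>2" "d\<^sup>2"] by (simp add: one_le_power)
      moreover have "(2 * M * d)\<^sup>2 = 4 * (M\<^sup>2 * d\<^sup>2)" by (simp add: power_mult_distrib)
      ultimately show ?thesis using zero_le_power2[of d] by linarith
    qed
    finally show ?thesis using M d by (simp add: power2_le_iff_abs_le)
  qed
  have damping: "C_ub / 4 * (\<Sum>i\<in>UNIV. \<bar>w $ i\<bar> * q $ i) \<le> h / 128"
  proof -
    let ?a = "\<chi> i. \<bar>w $ i\<bar>"
    have "norm ?a = norm w" by (simp add: norm_vec_def)
    moreover have "?a \<bullet> q \<le> norm ?a * norm q" by (rule norm_cauchy_schwarz)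
    ultimately have "(\<Sum>i\<in>UNIV. \<bar>w $ i\<bar> * q $ i) \<le> norm w * norm q"
      by (simp add: inner_vec_def)
    also have "\<dots> \<le> L * (2 * M * d)" using wL q_bound L by (intro mult_mono) auto
    finally have "C_ub / 4 * (\<Sum>i\<in>UNIV. \<bar>w $ i\<bar> * q $ i) \<le> C_ub / 4 * (L * (2 * M * d))"
      using C_lb C by (intro mult_left_mono) auto
    also have "\<dots> = (C_ub * M) * (L * d / 2)" by simp
    also have "\<dots> \<le> ((s / L)\<^sup>2 / 64) * (L * d / 2)" using C_ubM L d by (intro mult_right_mono) auto
    also have "\<dots> = (s / L) * (s * d) / 128" using L by (simp add: power2_eq_square)
    also have "\<dots> \<le> 1 * h / 128"
      using ratio h(1) s d by (intro divide_right_mono mult_mono) (auto simp: d_def)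
    finally show ?thesis by simp
  qed
  have "w \<bullet> e - C_ub / 4 * (\<Sum>i\<in>UNIV. \<bar>w $ i\<bar> * q $ i) - g / 4 * (norm w)\<^sup>2
      = (\<Sum>i\<in>UNIV. e $ i * w $ i - C_ub / 4 * (\<bar>w $ i\<bar> * q $ i) - g / 4 * (w $ i)\<^sup>2)"
    by (simp add: norm2 inner_vec_def sum_subtractf sum_distrib_left mult.commute)
  also have "\<dots> \<le> e \<bullet> u"
    unfolding inner_vec_def inner_real_def by (intro sum_mono coord)
  finally have descent: "h * (127 / 128 - \<gamma> / 4) \<le> e \<bullet> u"
    using damping hw gw by (simp add: algebra_simps)
  have "g\<^sup>2 * (norm u)\<^sup>2 \<le> g * (9 / 4 * (\<gamma> * h))"
  proof -
    have "g\<^sup>2 * (norm u)\<^sup>2 \<le> g\<^sup>2 * (9 / 4 * (norm w)\<^sup>2)" using u_bound by (intro mult_left_mono) auto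
    also have "\<dots> = g * (9 / 4 * (g * (norm w)\<^sup>2))" by (simp add: power2_eq_square)
    finally show ?thesis unfolding gw .
  qed
  moreover have "2 * g * (h * (127 / 128 - \<gamma> / 4)) \<le> 2 * g * (e \<bullet> u)"
    using descent g0 by (intro mult_left_mono) auto
  moreover have "g * h * (11 / 4 * \<gamma>) \<le> g * h * (63 / 64)"
    using \<gamma>' g0 h0 by (intro mult_left_mono) auto
  ultimately have "(norm (x' * x' - zs))\<^sup>2 \<le> d\<^sup>2 - g * h"
    unfolding step by (simp add: algebra_simps)
  moreover have "\<gamma> * (s / L)\<^sup>2 * d\<^sup>2 \<le> g * h"
  proof -
    have "s * d / L \<le> h / norm w"
      using h(1) h0 w0 wL by (intro frac_le) (auto simp: d_def)
    then have "(s * d / L)\<^sup>2 \<le> (h / norm w)\<^sup>2" using s d L by (intro power_mono) auto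
    then have "\<gamma> * (s * d / L)\<^sup>2 \<le> \<gamma> * (h / norm w)\<^sup>2" using \<gamma> by (intro mult_left_mono) auto
    then show ?thesis by (simp add: g power_divide power_mult_distrib power2_eq_square mult.assoc mult.left_commute)
  qed
  ultimately show ?thesis by (simp add: d_def algebra_simps)
qed

theorem corollary5p4:
  fixes A :: "real^'r^'m"
    and zstar :: "real^'r"
    and b :: "real^'m"
    and F :: "real^'r \<Rightarrow> real^'r"
    and h :: "real^'r \<Rightarrow> real"
    and \<gamma> C_lb C_ub :: real
    and gam lam :: "nat \<Rightarrow> real"
    and v x :: "nat \<Rightarrow> real^'r"
  assumes "CARD('r) \<le> CARD('m)"
    and "rank A = min CARD('m) CARD('r)"
    and "\<And>i. 0 \<le> zstar $ i"
    and "b = A *v zstar"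
    and "F = (\<lambda>x. x * x)"
    and "h = (\<lambda>z. norm (A *v z - b))"
    and "lmm_subgradient_method h F gam lam v x"
    and "polyak_configuration h F \<gamma> C_lb C_ub gam lam v x"
    and "\<gamma> \<le> min 1 (C_lb / 2)"
    and "C_ub \<le> 1 / (64 * max (sqrt (real CARD('r) - real (card (supp zstar)))) 1) * (1 / (kappa A)\<^sup>2)"
    and "ereal (norm (x 0 * x 0 - zstar)) \<le> ereal (1/2) * min (min_gap zstar) (min_nonzero zstar)"
  shows "\<forall>k. (norm (x k * x k - zstar))\<^sup>2
               \<le> (1 - \<gamma> / 8 * (1 / (kappa A)\<^sup>2)) ^ k * (norm (x 0 * x 0 - zstar))\<^sup>2"
proof -
  define s where "s = sigma_min A"
  define L where "L = sigma_max A"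
  define dk where "dk k = norm (x k * x k - zstar)" for k
  define \<rho> where "\<rho> = (s / L)\<^sup>2"
  have inj: "inj ((*v) A)"
    using assms(1,2) by (simp add: full_rank_injective[symmetric])
  note sv = singular_value_bounds[OF inj, folded s_def L_def]
  have \<rho>: "1 / (kappa A)\<^sup>2 = \<rho>" "0 \<le> \<rho>" "\<rho> \<le> 1"
    using sv(1,2) by (simp_all add: kappa_def s_def L_def \<rho>_def power_divide power_le_one power_mono)
  have h: "h z = norm (A *v (z - zstar))" for z
    using assms(4,6) by (simp add: matrix_vector_mult_diff_distrib)
  have h_pos: "0 < h z" if "z \<noteq> zstar" for z
    using sv(3)[of "z - zstar"] sv(1) that unfolding h
    by (smt (verit) mult_pos_pos right_minus_eq zero_less_norm_iff)
  have h_zero: "h zstar = 0" by (simp add: h)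
  note opt = square_minimizer[of zstar h, OF assms(3) h_zero h_pos]
  note config = assms(8)[unfolded polyak_configuration_def]
  have \<gamma>: "0 < \<gamma>" "\<gamma> \<le> 1" "\<gamma> \<le> C_lb / 2" and C: "0 < C_lb" "C_lb \<le> C_ub"
    using config assms(9) by auto
  have gam: "gam k = \<gamma> * (h (x k * x k) / (norm (\<chi> i. if x k $ i = 0 then 0 else v k $ i))\<^sup>2)"
    and lam: "C_lb * dk k \<le> lam k" "lam k \<le> C_ub * dk k" for k
    using config opt by (auto simp: assms(5) orth_proj_range_jacobian_square dk_def dist_norm)
  have v: "v k \<in> subdifferential h (x k * x k)"
    and x: "x (Suc k) = lmm_step (\<lambda>x. x * x) (gam k) (lam k) (v k) (x k)" for k
    using assms(5,7) by (auto simp: lmm_subgradient_method_def)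
  define r where "r = 1 - \<gamma> / 8 * \<rho>"
  have r: "0 \<le> r" "r \<le> 1"
    using \<gamma> \<rho> mult_mono[of \<gamma> 1 \<rho> 1] by (auto simp: r_def)
  have near0: "dk 0 \<le> zstar $ i / 2" if "zstar $ i \<noteq> 0" for i
  proof -
    have "min (min_gap zstar) (min_nonzero zstar) \<le> ereal (zstar $ i)"
      using that by (auto simp: min_nonzero_def supp_def intro!: min.coboundedI2 INF_lower)
    then have "ereal (1/2) * min (min_gap zstar) (min_nonzero zstar) \<le> ereal (1/2) * ereal (zstar $ i)"
      by (intro ereal_mult_left_mono) auto
    with assms(11) have "ereal (dk 0) \<le> ereal (1/2) * ereal (zstar $ i)"
      unfolding dk_def by (rule order_trans)
    then show ?thesis by simp
  qed
  have contraction: "(dk (Suc k))\<^sup>2 \<le> r * (dk k)\<^sup>2" if near: "dk k \<le> dk 0" for k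
  proof (cases "x k * x k = zstar")
    case True
    then have "gam k = 0" by (simp add: gam h_zero)
    then have "x (Suc k) = x k" by (simp add: x lmm_step_def)
    then show ?thesis using True by (simp add: dk_def)
  next
    case False
    have "0 < dk k" using False by (simp add: dk_def)
    then have "0 < lam k" using lam(1)[of k] C by (smt (verit) mult_pos_pos)
    then have step: "x (Suc k) = (\<chi> i. x k $ i - gam k * (2 * x k $ i * v k $ i / (4 * (x k $ i)\<^sup>2 + lam k)))"
      by (simp add: x lmm_step_square)
    have sub: "v k \<in> subdifferential (\<lambda>z. norm (A *v z - A *v zstar)) (x k * x k)"
      using v[of k] assms(4,6) by simp
    note sub = norm_residual_subgradient[OF sub sv(4), folded h]
    have "(dk (Suc k))\<^sup>2 \<le> (1 - \<gamma> * \<rho>) * (dk k)\<^sup>2"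
      unfolding \<rho>_def dk_def
    proof (rule lmm_square_step_contraction[where v = "v k" and h = "h (x k * x k)" and C_lb = C_lb
          and C_ub = C_ub and mu = "lam k", OF assms(3) _ _ sv(1,2) _ _ _ \<gamma>(1,3) C(2) _ gam _ _ step])
      show "norm (x k * x k - zstar) \<le> zstar $ i / 2" if "zstar $ i \<noteq> 0" for i
        using near near0[OF that] by (simp add: dk_def)
      show "C_ub \<le> 1 / (64 * max (sqrt (real CARD('r) - real (card (supp zstar)))) 1) * (s / L)\<^sup>2"
        using assms(10) \<rho>(1) by (simp add: \<rho>_def)
    qed (use False sub sv(3) lam[of k] in \<open>auto simp: h dk_def\<close>)
    also have "\<dots> \<le> r * (dk k)\<^sup>2"
      using \<gamma> \<rho> by (intro mult_right_mono) (auto simp: r_def)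
    finally show ?thesis .
  qed
  have "dk k \<le> dk 0 \<and> (dk k)\<^sup>2 \<le> r ^ k * (dk 0)\<^sup>2" for k
  proof (induction k)
    case (Suc k)
    have step: "(dk (Suc k))\<^sup>2 \<le> r * (dk k)\<^sup>2" using contraction Suc by blast
    also have "\<dots> \<le> (dk k)\<^sup>2" using r by (simp add: mult_left_le_one_le)
    finally have "dk (Suc k) \<le> dk k" by (rule power2_le_imp_le) (simp add: dk_def)
    moreover have "r * (dk k)\<^sup>2 \<le> r * (r ^ k * (dk 0)\<^sup>2)"
      using Suc r by (intro mult_left_mono) auto
    ultimately show ?case using Suc step by auto
  qed simp
  then show ?thesis
    by (simp add: dk_def r_def \<rho>(1))
qed

end
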